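(* Let $(X,d)$ be a compact metric space, let $\mathbb{I}=\{S_1,\dots,S_N\}$ be an iterated function system of similarities on $X$ with similarity dimension $s$, and let $C\subseteq X$ be a non-empty compact set. Let $F_\emptyset$ be the homogeneous attractor of $\mathbb{I}$ and $F_C$ the inhomogeneous attractor of $\mathbb{I}$ with condensation $C$. Then $$\max\{\overline{\dim}_{\mathrm B}F_\emptyset,\ \overline{\dim}_{\mathrm B}C\}\ \le\ \overline{\dim}_{\mathrm B}F_C\ \le\ \max\{s,\ \overline{\dim}_{\mathrm B}C\}.$$
   Context: An iterated function system (IFS) of similarities on $X$ is a finite collection of maps $S_i:X\to X$ such that for each $i$ there is a constant $\mathrm{Lip}(S_i)\in(0,1)$ with $d(S_i(x),S_i(y))=\mathrm{Lip}(S_i)\,d(x,y)$ for all $x,y\in X$. The homogeneous attractor $F_\emptyset$ is the unique non-empty compact set with $F_\emptyset=\bigcup_{i=1}^N S_i(F_\emptyset)$. For a non-empty compact condensation set $C\subseteq X$, the inhomogeneous attractor $F_C$ is the unique non-empty compact set with $F_C=\bigcup_{i=1}^N S_i(F_C)\cup C$. The similarity dimension $s$ is the unique solution of $\sum_{i=1}^N \mathrm{Lip}(S_i)^s=1$. For a non-empty set $E\subseteq X$ and $\delta>0$, $N_\delta(E)$ is the minimum number of sets of diameter at most $\delta$ required to cover $E$, and $\overline{\dim}_{\mathrm B}E=\limsup_{\delta\to0}\frac{\log N_\delta(E)}{-\log\delta}$. *)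

theory Defs
  imports "HOL-Analysis.Analysis"
begin

text \<open>
  The underlying compact metric space is a compact set \<open>X\<close> in a type of class \<open>metric_space\<close>;
  the maps \<open>S 1, \<dots>, S N\<close> only matter on \<open>X\<close>. The ratio \<open>r i\<close> is Lip(\<open>S i\<close>). It is carried as data
  since it is not determined by \<open>S i\<close> when \<open>X\<close> is a single point.
\<close>

definition similarity_ifs ::
  "'a::metric_space set \<Rightarrow> nat \<Rightarrow> (nat \<Rightarrow> 'a \<Rightarrow> 'a) \<Rightarrow> (nat \<Rightarrow> real) \<Rightarrow> bool" where
  "similarity_ifs X N S r \<longleftrightarrow>
     N \<ge> 1 \<and>
     (\<forall>i\<in>{1..N}. S i ` X \<subseteq> X \<and> 0 < r i \<and> r i < 1 \<and>
        (\<forall>x\<in>X. \<forall>y\<in>X. dist (S i x) (S i y) = r i * dist x y))"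

definition similarity_dim :: "nat \<Rightarrow> (nat \<Rightarrow> real) \<Rightarrow> real" where
  "similarity_dim N r = (THE s. (\<Sum>i=1..N. r i powr s) = 1)"

definition is_attractor ::
  "'a::metric_space set \<Rightarrow> nat \<Rightarrow> (nat \<Rightarrow> 'a \<Rightarrow> 'a) \<Rightarrow> 'a set \<Rightarrow> 'a set \<Rightarrow> bool" where
  "is_attractor X N S C F \<longleftrightarrow>
     F \<subseteq> X \<and> F \<noteq> {} \<and> compact F \<and> F = (\<Union>i\<in>{1..N}. S i ` F) \<union> C"

text \<open>The homogeneous attractor is the case \<open>C = {}\<close>.\<close>

definition attractor ::
  "'a::metric_space set \<Rightarrow> nat \<Rightarrow> (nat \<Rightarrow> 'a \<Rightarrow> 'a) \<Rightarrow> 'a set \<Rightarrow> 'a set" where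
  "attractor X N S C = (THE F. is_attractor X N S C F)"

text \<open>
  Boundedness is required explicitly because \<^const>\<open>diameter\<close> is unspecified on unbounded sets.
  Covering sets need not lie in \<open>X\<close>; intersecting them with \<open>E\<close> shows that this does not change the
  minimum. For \<open>\<delta> > 0\<close> the minimum exists when \<open>E\<close> is totally bounded, in particular when \<open>E\<close> is compact.
\<close>

definition covering_number :: "real \<Rightarrow> 'a::metric_space set \<Rightarrow> nat" where
  "covering_number \<delta> E =
     (LEAST n. \<exists>\<U>. finite \<U> \<and> card \<U> = n \<and> E \<subseteq> \<Union>\<U> \<and>
        (\<forall>U\<in>\<U>. bounded U \<and> diameter U \<le> \<delta>))"

text \<open>The value is in \<^typ>\<open>ereal\<close>, since a compact metric space can have infinite upper box dimension.\<close>

definition upper_box_dim :: "'a::metric_space set \<Rightarrow> ereal" where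
  "upper_box_dim E =
     Limsup (at_right 0) (\<lambda>\<delta>. ereal (ln (real (covering_number \<delta> E)) / (- ln \<delta>)))"

text \<open>The definite descriptions above are well defined.\<close>

lemma covering_number_exists:
  fixes E :: "'a::metric_space set"
  assumes "compact E" "\<delta> > 0"
  shows "\<exists>n \<U>. finite \<U> \<and> card \<U> = n \<and> E \<subseteq> \<Union>\<U> \<and> (\<forall>U\<in>\<U>. bounded U \<and> diameter U \<le> \<delta>)"
proof -
  obtain k where k: "finite k" "E \<subseteq> (\<Union>x\<in>k. ball x (\<delta>/2))"
    using seq_compact_imp_totally_bounded[of E] assms by (metis compact_imp_seq_compact half_gt_zero)
  have "dist y z \<le> \<delta>" if "y \<in> ball x (\<delta>/2)" "z \<in> ball x (\<delta>/2)" for x y z :: 'a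
    using dist_triangle2[of y z x] that by (simp add: dist_commute)
  then have "diameter (ball x (\<delta>/2)) \<le> \<delta>" for x :: 'a
    unfolding diameter_def using assms(2) by (auto intro!: cSUP_least simp del: mem_ball)
  then show ?thesis
    using k by (intro exI[of _ "card ((\<lambda>x. ball x (\<delta>/2)) ` k)"] exI[of _ "(\<lambda>x. ball x (\<delta>/2)) ` k"]) auto
qed

lemma similarity_dim_ex1:
  assumes "similarity_ifs X N S r"
  shows "\<exists>!s. (\<Sum>i=1..N. r i powr s) = 1"
proof -
  have N: "N \<ge> 1" and r: "\<And>i. i \<in> {1..N} \<Longrightarrow> 0 < r i \<and> r i < 1"
    using assms by (auto simp: similarity_ifs_def)
  let ?f = "\<lambda>s. \<Sum>i=1..N. r i powr s"
  have less: "?f t < ?f s" if "s < t" for s t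
  proof (rule sum_strict_mono)
    show "r i powr t < r i powr s" if "i \<in> {1..N}" for i
      using r[OF that] \<open>s < t\<close> by (simp add: powr_less_mono')
  qed (use N in auto)
  have lim: "(?f \<longlongrightarrow> (\<Sum>i=1..N. 0)) at_top"
  proof (rule tendsto_sum)
    fix i assume i: "i \<in> {1..N}"
    have "((\<lambda>s. r i powr s) \<longlongrightarrow> 0) at_top"
    proof -
      have "filterlim (\<lambda>s. ln (r i) * s) at_bot at_top"
        using r[OF i] by (intro filterlim_tendsto_neg_mult_at_bot[OF tendsto_const])
          (auto simp: filterlim_ident)
      then have "((\<lambda>s. exp (ln (r i) * s)) \<longlongrightarrow> 0) at_top"
        by (rule filterlim_compose[OF exp_at_bot])
      then show ?thesis using r[OF i] by (simp add: powr_def mult.commute)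
    qed
    then show "((\<lambda>s. r i powr s) \<longlongrightarrow> 0) at_top" .
  qed
  then have "\<forall>\<^sub>F s in at_top. ?f s < 1 \<and> s \<ge> 0"
    by (intro eventually_conj order_tendstoD(2)[OF lim] eventually_ge_at_top) simp
  then obtain b where b: "?f b < 1" "b \<ge> 0"
    by (metis (no_types, lifting) eventually_happens' trivial_limit_at_top_linorder)
  have "?f 0 = (\<Sum>i=1..N. 1)" using r by (intro sum.cong) force+
  then have "?f 0 \<ge> 1" using N by simp
  moreover have "continuous_on {0..b} ?f"
    using r by (intro continuous_intros) force+
  ultimately obtain s where "?f s = 1"
    using IVT2'[of ?f b 1 0] b by auto
  moreover have "t = s" if "?f t = 1" for t
    using less[of s t] less[of t s] that \<open>?f s = 1\<close> by (metis less_irrefl linorder_neqE)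
  ultimately show ?thesis by blast
qed

lemma attractor_ex1:
  assumes X: "compact X" "X \<noteq> {}" and ifs: "similarity_ifs X N S r" and C: "compact C" "C \<subseteq> X"
  shows "\<exists>!F. is_attractor X N S C F"
proof -
  have N: "N \<ge> 1"
    and r: "\<And>i. i \<in> {1..N} \<Longrightarrow> 0 < r i \<and> r i < 1"
    and SX: "\<And>i x. i \<in> {1..N} \<Longrightarrow> x \<in> X \<Longrightarrow> S i x \<in> X"
    and dS: "\<And>i x y. i \<in> {1..N} \<Longrightarrow> x \<in> X \<Longrightarrow> y \<in> X \<Longrightarrow> dist (S i x) (S i y) = r i * dist x y"
    using ifs unfolding similarity_ifs_def by blast+
  have inj: "x = y" if "i \<in> {1..N}" "x \<in> X" "y \<in> X" "S i x = S i y" for i x y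
    using dS[OF that(1-3)] r[OF that(1)] that(4) by auto
  have cS: "continuous_on X (S i)" if "i \<in> {1..N}" for i
    unfolding continuous_on_iff
  proof (intro ballI allI impI)
    fix x and e :: real assume "x \<in> X" "0 < e"
    have "dist (S i y) (S i x) < e" if "y \<in> X" "dist y x < e" for y
    proof -
      have "r i * dist y x \<le> 1 * dist y x"
        using r[OF \<open>i \<in> {1..N}\<close>] by (intro mult_right_mono) auto
      then show ?thesis using dS[OF \<open>i \<in> {1..N}\<close> that(1) \<open>x \<in> X\<close>] that(2) by simp
    qed
    then show "\<exists>d>0. \<forall>y\<in>X. dist y x < d \<longrightarrow> dist (S i y) (S i x) < e" using \<open>0 < e\<close> by blast
  qed
  define \<Phi> where "\<Phi> A = (\<Union>i\<in>{1..N}. S i ` A) \<union> C" for A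
  have mono: "\<Phi> A \<subseteq> \<Phi> B" if "A \<subseteq> B" for A B using that unfolding \<Phi>_def by blast
  define K where "K n = (\<Phi> ^^ n) X" for n
  have K0: "K 0 = X" and KS: "K (Suc n) = \<Phi> (K n)" for n by (simp_all add: K_def)
  have step: "K (Suc n) \<subseteq> K n" for n
  proof (induction n)
    case 0
    show ?case using SX C unfolding KS K0 \<Phi>_def by blast
  next
    case (Suc n)
    then show ?case using mono KS by metis
  qed
  have decr: "K n \<subseteq> K m" if "m \<le> n" for m n
    using lift_Suc_antimono_le[of K, OF step that] .
  have KX: "K n \<subseteq> X" for n using decr[of 0 n] K0 by simp
  have K: "compact (K n) \<and> K n \<noteq> {}" for n
  proof (induction n)
    case 0 then show ?case using X K0 by simp
  next
    case (Suc n)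
    have "compact (S i ` K n)" if "i \<in> {1..N}" for i
      using Suc continuous_on_subset[OF cS[OF that] KX] by (intro compact_continuous_image) auto
    then have "compact (\<Phi> (K n))" unfolding \<Phi>_def
      using C by (intro compact_Un compact_UN) auto
    moreover have "\<Phi> (K n) \<noteq> {}" unfolding \<Phi>_def using Suc N by auto
    ultimately show ?case by (simp add: KS)
  qed
  define F where "F = (\<Inter>n. K n)"
  have FX: "F \<subseteq> X" using KX[of 0] by (auto simp: F_def)
  have "F \<noteq> {}"
  proof -
    have "X \<inter> (\<Inter>n\<in>UNIV. K n) \<noteq> {}"
    proof (rule compact_imp_fip_image[OF X(1)])
      show "closed (K n)" for n using K compact_imp_closed by blast
      fix I' :: "nat set" assume "finite I'"
      then obtain m where "\<And>n. n \<in> I' \<Longrightarrow> n \<le> m" by (metis Max_ge)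
      then have "K m \<subseteq> X \<inter> (\<Inter>n\<in>I'. K n)" using decr KX by blast
      then show "X \<inter> (\<Inter>n\<in>I'. K n) \<noteq> {}" using K by blast
    qed
    then show ?thesis by (auto simp: F_def)
  qed
  moreover have "compact F"
  proof (rule closed_Int_compact[of F X, unfolded Int_absorb2[OF FX]])
    show "closed F" unfolding F_def using K compact_imp_closed by blast
  qed (rule X(1))
  moreover have "\<Phi> F = F"
  proof
    show "\<Phi> F \<subseteq> F"
    proof -
      have "\<Phi> F \<subseteq> K (Suc n)" for n unfolding KS by (intro mono) (auto simp: F_def)
      then have "\<Phi> F \<subseteq> K n" for n using step by blast
      then show ?thesis unfolding F_def by blast
    qed
    show "F \<subseteq> \<Phi> F"
    proof
      fix x assume x: "x \<in> F"
      show "x \<in> \<Phi> F"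
      proof (cases "\<exists>i\<in>{1..N}. \<forall>n. x \<in> S i ` K n")
        case True
        then obtain i where i: "i \<in> {1..N}" "\<And>n. x \<in> S i ` K n" by blast
        then have "\<forall>n. \<exists>y. y \<in> K n \<and> x = S i y" by blast
        from choice[OF this] obtain y where y: "\<And>n. y n \<in> K n" "\<And>n. x = S i (y n)" by blast
        have eq: "y n = y 0" for n
          using y(2)[of n] y(2)[of 0] by (intro inj[OF i(1) subsetD[OF KX y(1)] subsetD[OF KX y(1)]]) simp
        have "y 0 \<in> K n" for n using y(1)[of n] unfolding eq[of n] .
        then have "y 0 \<in> F" by (simp add: F_def)
        then show ?thesis unfolding \<Phi>_def using i(1) y(2)[of 0] by blast
      next
        case False
        then have "\<forall>i. \<exists>n. i \<in> {1..N} \<longrightarrow> x \<notin> S i ` K n" by blast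
        from choice[OF this] obtain n where n: "\<And>i. i \<in> {1..N} \<Longrightarrow> x \<notin> S i ` K (n i)" by blast
        define m where "m = Max (n ` {1..N})"
        have "x \<notin> S i ` K m" if "i \<in> {1..N}" for i
        proof -
          have "n i \<le> m" unfolding m_def using that by simp
          then show ?thesis using n[OF that] decr[of "n i" m] by blast
        qed
        moreover have "x \<in> \<Phi> (K m)" using x KS[of m] unfolding F_def by blast
        ultimately show ?thesis unfolding \<Phi>_def by blast
      qed
    qed
  qed
  ultimately have ex: "is_attractor X N S C F"
    unfolding is_attractor_def \<Phi>_def[symmetric] by (intro conjI FX) simp_all
  have sub: "F \<subseteq> G" if F: "is_attractor X N S C F" and G: "is_attractor X N S C G" for F G
  proof -
    have F: "F \<subseteq> X" "F \<noteq> {}" "compact F" "\<And>x. x \<in> F \<Longrightarrow> x \<notin> C \<Longrightarrow> \<exists>i\<in>{1..N}. \<exists>y\<in>F. x = S i y"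
      using F unfolding is_attractor_def by blast+
    have G: "G \<subseteq> X" "G \<noteq> {}" "compact G" "C \<subseteq> G" "\<And>i x. i \<in> {1..N} \<Longrightarrow> x \<in> G \<Longrightarrow> S i x \<in> G"
      using G unfolding is_attractor_def by blast+
    obtain x where x: "x \<in> F" "\<And>y. y \<in> F \<Longrightarrow> infdist y G \<le> infdist x G"
      using continuous_attains_sup[OF F(3,2) continuous_on_infdist[OF continuous_on_id, of _ G]]
      by blast
    have "infdist x G = 0"
    proof (cases "x \<in> C")
      case True
      then have "x \<in> G" using G(4) by blast
      then show ?thesis by simp
    next
      case False
      then obtain i y where i: "i \<in> {1..N}" "y \<in> F" "x = S i y" using F(4)[OF x(1)] by blast
      obtain z where z: "z \<in> G" "\<And>w. w \<in> G \<Longrightarrow> dist y z \<le> dist y w"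
        using continuous_attains_inf[OF G(3,2) continuous_on_dist[OF continuous_on_const continuous_on_id], of y]
        by blast
      then have "dist y z \<le> infdist y G"
        unfolding infdist_notempty[OF G(2)] by (intro cINF_greatest G(2))
      then have z_eq: "infdist y G = dist y z" using infdist_le[OF z(1), of y] by simp
      have "S i z \<in> G" using G(5) i(1) z(1) .
      then have "infdist x G \<le> dist (S i y) (S i z)" unfolding i(3) by (rule infdist_le)
      also have "\<dots> = r i * infdist y G" using dS[OF i(1), of y z] i(2) z(1) z_eq F(1) G(1) by (metis subsetD)
      also have "\<dots> \<le> r i * infdist x G" using r[OF i(1)] x(2)[OF i(2)] by (intro mult_left_mono) auto
      finally have "(1 - r i) * infdist x G \<le> 0" by (simp add: algebra_simps)
      then show ?thesis using r[OF i(1)] infdist_nonneg[of x G] by (simp add: mult_le_0_iff)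
    qed
    then have "infdist y G = 0" if "y \<in> F" for y
      using x(2)[OF that] infdist_nonneg[of y G] by simp
    then show ?thesis using G(2,3) compact_imp_closed in_closed_iff_infdist_zero by blast
  qed
  show ?thesis
  proof (rule ex1I, rule ex)
    fix G assume "is_attractor X N S C G"
    then show "G = F" using sub[OF ex] sub[OF _ ex] by (intro subset_antisym) simp_all
  qed
qed

end

theory Submission
  imports Defs
begin

text \<open>
  Write \<open>F\<close> for the inhomogeneous attractor and \<open>N\<^sub>\<delta>\<close> for covering numbers.

  The lower bound is monotonicity of the upper box dimension: \<open>C \<subseteq> F\<close> by the defining equation, and
  the homogeneous attractor lies in \<open>F\<close> because every \<open>S i\<close> maps \<open>F\<close> into itself, so the system
  restricted to \<open>F\<close> already has a homogeneous attractor inside \<open>F\<close>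
  (\<open>homogeneous_attractor_subset\<close>).

  For the upper bound, a cover of \<open>F\<close> at scale \<open>\<delta> / r i\<close> is mapped by \<open>S i\<close> to a cover of \<open>S i ` F\<close> at
  scale \<open>\<delta>\<close>. Hence the equation \<open>F = (\<Union>i. S i ` F) \<union> C\<close> gives the renewal inequality
  \<open>N\<^sub>\<delta>(F) \<le> (\<Sum>i. N\<^bsub>\<delta> / r i\<^esub>(F)) + N\<^sub>\<delta>(C)\<close> (\<open>covering_number_self_similar_le\<close>).
  Let \<open>t\<close> exceed both the similarity dimension and the upper box dimension of \<open>C\<close>. Then
  \<open>N\<^sub>\<delta>(C) \<le> \<delta> powr - t\<close> for small \<open>\<delta>\<close>, and \<open>q = (\<Sum>i. r i powr t) < 1\<close>. Substituting a bound
  \<open>A * \<delta> powr - t\<close> on the right-hand side of the inequality yields \<open>(q * A + 1) * \<delta> powr - t\<close>, which is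
  again at most \<open>A * \<delta> powr - t\<close> as soon as \<open>A \<ge> 1 / (1 - q)\<close>. So the bound propagates from coarse
  scales to all small scales (\<open>renewal_inequality_powr_bound\<close>), and the upper box dimension of \<open>F\<close> is
  at most \<open>t\<close>.
\<close>

section \<open>Covering numbers\<close>

lemma covering_number_le:
  assumes "finite \<U>" "E \<subseteq> \<Union>\<U>" "\<delta> \<ge> 0"
    and "\<forall>U\<in>\<U>. \<forall>x\<in>U. \<forall>y\<in>U. dist x y \<le> \<delta>"
  shows "covering_number \<delta> E \<le> card \<U>"
  unfolding covering_number_def
proof (rule Least_le, rule exI[of _ \<U>], intro conjI ballI)
  fix U assume U: "U \<in> \<U>"
  show "bounded U" using assms(4) U unfolding bounded_two_points by blast
  show "diameter U \<le> \<delta>"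
    unfolding diameter_def using assms(3,4) U by (auto intro!: cSUP_least)
qed (use assms(1,2) in simp_all)

lemma minimal_cover_exists:
  fixes E :: "'a::metric_space set"
  assumes "compact E" "\<delta> > 0"
  obtains \<U> where "finite \<U>" "card \<U> = covering_number \<delta> E" "E \<subseteq> \<Union>\<U>"
    "\<forall>U\<in>\<U>. \<forall>x\<in>U. \<forall>y\<in>U. dist x y \<le> \<delta>"
proof -
  obtain \<U> where \<U>: "finite \<U>" "card \<U> = covering_number \<delta> E" "E \<subseteq> \<Union>\<U>"
    "\<forall>U\<in>\<U>. bounded U \<and> diameter U \<le> \<delta>"
    using LeastI_ex[OF covering_number_exists[OF assms]] unfolding covering_number_def by blast
  show thesis
  proof (rule that[OF \<U>(1-3)], intro ballI)
    fix U x y assume "U \<in> \<U>" "x \<in> U" "y \<in> U"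
    then show "dist x y \<le> \<delta>"
      using diameter_bounded_bound[of U x y] \<U>(4) by force
  qed
qed

lemma covering_number_mono:
  assumes "compact B" "A \<subseteq> B" "\<delta> > 0"
  shows "covering_number \<delta> A \<le> covering_number \<delta> B"
proof -
  obtain \<U> where \<U>: "finite \<U>" "card \<U> = covering_number \<delta> B" "B \<subseteq> \<Union>\<U>"
    "\<forall>U\<in>\<U>. \<forall>x\<in>U. \<forall>y\<in>U. dist x y \<le> \<delta>"
    using minimal_cover_exists[OF assms(1,3)] by blast
  have "covering_number \<delta> A \<le> card \<U>"
    using covering_number_le[OF \<U>(1) subset_trans[OF assms(2) \<U>(3)] less_imp_le[OF assms(3)] \<U>(4)] .
  then show ?thesis using \<U>(2) by simp
qed

lemma covering_number_antimono_scale: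
  assumes "compact E" "0 < \<delta>" "\<delta> \<le> \<epsilon>"
  shows "covering_number \<epsilon> E \<le> covering_number \<delta> E"
proof -
  obtain \<U> where \<U>: "finite \<U>" "card \<U> = covering_number \<delta> E" "E \<subseteq> \<Union>\<U>"
    "\<forall>U\<in>\<U>. \<forall>x\<in>U. \<forall>y\<in>U. dist x y \<le> \<delta>"
    using minimal_cover_exists[OF assms(1,2)] by blast
  have "covering_number \<epsilon> E \<le> card \<U>"
  proof (rule covering_number_le[OF \<U>(1,3)])
    show "0 \<le> \<epsilon>" using assms(2,3) by linarith
    show "\<forall>U\<in>\<U>. \<forall>x\<in>U. \<forall>y\<in>U. dist x y \<le> \<epsilon>"
      using \<U>(4) assms(3) order_trans by blast
  qed
  then show ?thesis using \<U>(2) by simp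
qed

lemma covering_number_pos:
  assumes "compact E" "E \<noteq> {}" "\<delta> > 0"
  shows "covering_number \<delta> E \<ge> 1"
proof -
  obtain \<U> where \<U>: "finite \<U>" "card \<U> = covering_number \<delta> E" "E \<subseteq> \<Union>\<U>"
    "\<forall>U\<in>\<U>. \<forall>x\<in>U. \<forall>y\<in>U. dist x y \<le> \<delta>"
    using minimal_cover_exists[OF assms(1,3)] by blast
  have "\<U> \<noteq> {}" using \<U>(3) assms(2) by auto
  then have "card \<U> \<noteq> 0" using \<U>(1) by simp
  then show ?thesis using \<U>(2) by simp
qed

text \<open>
  The image of a cover at scale \<open>\<delta> / c\<close> covers the image at scale \<open>\<delta>\<close>. The covering sets are first cut
  down to \<open>E\<close>, as \<open>f\<close> is controlled only there.
\<close>

lemma covering_number_image_le: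
  assumes "compact E" "\<delta> > 0" "c > 0"
    and "\<And>x y. x \<in> E \<Longrightarrow> y \<in> E \<Longrightarrow> dist (f x) (f y) \<le> c * dist x y"
  shows "covering_number \<delta> (f ` E) \<le> covering_number (\<delta> / c) E"
proof -
  obtain \<U> where \<U>: "finite \<U>" "card \<U> = covering_number (\<delta> / c) E" "E \<subseteq> \<Union>\<U>"
    "\<forall>U\<in>\<U>. \<forall>x\<in>U. \<forall>y\<in>U. dist x y \<le> \<delta> / c"
    using minimal_cover_exists[OF assms(1) divide_pos_pos[OF assms(2,3)]] by blast
  have "covering_number \<delta> (f ` E) \<le> card ((\<lambda>U. f ` (U \<inter> E)) ` \<U>)"
  proof (rule covering_number_le)
    show "\<forall>V\<in>(\<lambda>U. f ` (U \<inter> E)) ` \<U>. \<forall>x\<in>V. \<forall>y\<in>V. dist x y \<le> \<delta>"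
    proof (intro ballI)
      fix V x y assume "V \<in> (\<lambda>U. f ` (U \<inter> E)) ` \<U>" "x \<in> V" "y \<in> V"
      then obtain U u v where uv: "U \<in> \<U>" "u \<in> U" "v \<in> U" "u \<in> E" "v \<in> E" "x = f u" "y = f v"
        by blast
      have "dist x y \<le> c * dist u v" using assms(4) uv by blast
      also have "\<dots> \<le> c * (\<delta> / c)" using assms(3) \<U>(4) uv by (intro mult_left_mono) auto
      finally show "dist x y \<le> \<delta>" using assms(3) by simp
    qed
    show "f ` E \<subseteq> \<Union> ((\<lambda>U. f ` (U \<inter> E)) ` \<U>)" using \<U>(3) by blast
  qed (use \<U>(1) assms(2) in auto)
  also have "\<dots> \<le> card \<U>" by (rule card_image_le[OF \<U>(1)])
  finally show ?thesis using \<U>(2) by simp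
qed

lemma covering_number_Un_le:
  assumes "compact A" "compact B" "\<delta> > 0"
  shows "covering_number \<delta> (A \<union> B) \<le> covering_number \<delta> A + covering_number \<delta> B"
proof -
  obtain \<U> where \<U>: "finite \<U>" "card \<U> = covering_number \<delta> A" "A \<subseteq> \<Union>\<U>"
    "\<forall>U\<in>\<U>. \<forall>x\<in>U. \<forall>y\<in>U. dist x y \<le> \<delta>"
    using minimal_cover_exists[OF assms(1,3)] by blast
  obtain \<V> where \<V>: "finite \<V>" "card \<V> = covering_number \<delta> B" "B \<subseteq> \<Union>\<V>"
    "\<forall>U\<in>\<V>. \<forall>x\<in>U. \<forall>y\<in>U. dist x y \<le> \<delta>"
    using minimal_cover_exists[OF assms(2,3)] by blast
  have "covering_number \<delta> (A \<union> B) \<le> card (\<U> \<union> \<V>)"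
  proof (rule covering_number_le)
    show "A \<union> B \<subseteq> \<Union>(\<U> \<union> \<V>)" using \<U>(3) \<V>(3) by blast
    show "\<forall>U\<in>\<U> \<union> \<V>. \<forall>x\<in>U. \<forall>y\<in>U. dist x y \<le> \<delta>"
      using \<U>(4) \<V>(4) by blast
  qed (use \<U>(1) \<V>(1) assms(3) in auto)
  also have "\<dots> \<le> card \<U> + card \<V>" by (rule card_Un_le)
  finally show ?thesis using \<U>(2) \<V>(2) by simp
qed

lemma covering_number_UN_le:
  assumes "finite I" "\<And>i. i \<in> I \<Longrightarrow> compact (A i)" "\<delta> > 0"
  shows "covering_number \<delta> (\<Union>i\<in>I. A i) \<le> (\<Sum>i\<in>I. covering_number \<delta> (A i))"
  using assms(1,2)
proof (induction I)
  case empty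
  show ?case using covering_number_le[of "{}" "{}" \<delta>] assms(3) by simp
next
  case (insert j I)
  have "covering_number \<delta> (A j \<union> (\<Union>i\<in>I. A i))
      \<le> covering_number \<delta> (A j) + covering_number \<delta> (\<Union>i\<in>I. A i)"
    by (intro covering_number_Un_le compact_UN) (use insert assms(3) in auto)
  then show ?case using insert by simp
qed

section \<open>Upper box dimension and polynomial growth of covering numbers\<close>

lemma upper_box_dim_mono:
  assumes "compact B" "A \<subseteq> B"
  shows "upper_box_dim A \<le> upper_box_dim B"
  unfolding upper_box_dim_def
proof (rule Limsup_mono)
  have "\<forall>\<^sub>F \<delta>::real in at_right 0. 0 < \<delta> \<and> \<delta> < 1"
    unfolding eventually_at_right_field by (intro exI[of _ 1]) auto
  then show "\<forall>\<^sub>F \<delta> in at_right 0. ereal (ln (real (covering_number \<delta> A)) / - ln \<delta>)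
      \<le> ereal (ln (real (covering_number \<delta> B)) / - ln \<delta>)"
  proof eventually_elim
    case (elim \<delta>)
    have le: "covering_number \<delta> A \<le> covering_number \<delta> B"
      using covering_number_mono[OF assms] elim by blast
    \<comment> \<open>For an empty \<open>A\<close> the left-hand side is \<open>ln 0 = 0\<close>.\<close>
    have "ln (real (covering_number \<delta> A)) \<le> ln (real (covering_number \<delta> B))"
      using le by (cases "covering_number \<delta> A = 0"; cases "covering_number \<delta> B = 0") auto
    then have "ln (real (covering_number \<delta> A)) / - ln \<delta> \<le> ln (real (covering_number \<delta> B)) / - ln \<delta>"
      using elim by (intro divide_right_mono) (auto simp: ln_le_zero_iff)
    then show ?case by simp
  qed
qed

lemma covering_number_powr_bound_of_upper_box_dim_less:
  assumes "upper_box_dim E < ereal t"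
  obtains \<delta>\<^sub>0 where "\<delta>\<^sub>0 > 0"
    "\<And>\<delta>. 0 < \<delta> \<Longrightarrow> \<delta> < \<delta>\<^sub>0 \<Longrightarrow> real (covering_number \<delta> E) \<le> \<delta> powr - t"
proof -
  have "\<forall>\<^sub>F \<delta> in at_right 0. ereal (ln (real (covering_number \<delta> E)) / - ln \<delta>) < ereal t"
    using assms unfolding upper_box_dim_def by (rule Limsup_lessD)
  then obtain b where b: "b > 0"
    "\<And>\<delta>. 0 < \<delta> \<Longrightarrow> \<delta> < b \<Longrightarrow> ln (real (covering_number \<delta> E)) / - ln \<delta> < t"
    unfolding eventually_at_right_field by auto
  show thesis
  proof (rule that[of "min b 1"])
    fix \<delta> :: real assume \<delta>: "0 < \<delta>" "\<delta> < min b 1"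
    have pos: "- ln \<delta> > 0" using \<delta> by simp
    have "ln (real (covering_number \<delta> E)) < t * - ln \<delta>"
      using b(2)[of \<delta>] \<delta> pos_divide_less_eq[OF pos] by simp
    then have "exp (ln (real (covering_number \<delta> E))) \<le> exp (- t * ln \<delta>)" by simp
    then show "real (covering_number \<delta> E) \<le> \<delta> powr - t"
      using \<delta>(1) by (cases "covering_number \<delta> E = 0") (simp_all add: powr_def)
  qed (use b in simp)
qed

text \<open>
  Taking logarithms turns the constant \<open>A\<close> into the summand \<open>ln A / - ln \<delta>\<close>, which vanishes in the limit.
\<close>

lemma upper_box_dim_le_of_covering_number_powr_bound:
  assumes "compact E" "E \<noteq> {}" "A > 0" "\<delta>\<^sub>0 > 0"
    and "\<And>\<delta>. 0 < \<delta> \<Longrightarrow> \<delta> < \<delta>\<^sub>0 \<Longrightarrow> real (covering_number \<delta> E) \<le> A * \<delta> powr - t"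
  shows "upper_box_dim E \<le> ereal t"
proof -
  have "filterlim (\<lambda>\<delta>::real. - ln \<delta>) at_top (at_right 0)"
    using ln_at_0 by (simp add: filterlim_uminus_at_bot)
  then have "((\<lambda>\<delta>. ln A / - ln \<delta>) \<longlongrightarrow> 0) (at_right 0)"
    by (intro tendsto_divide_0[OF tendsto_const] filterlim_at_top_imp_at_infinity)
  then have "((\<lambda>\<delta>. ereal (ln A / - ln \<delta> + t)) \<longlongrightarrow> ereal (0 + t)) (at_right 0)"
    by (intro tendsto_ereal tendsto_add tendsto_const)
  then have lim: "Limsup (at_right 0) (\<lambda>\<delta>. ereal (ln A / - ln \<delta> + t)) = ereal t"
    by (simp add: lim_imp_Limsup)
  have "\<forall>\<^sub>F \<delta> in at_right 0. 0 < \<delta> \<and> \<delta> < min \<delta>\<^sub>0 1"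
    unfolding eventually_at_right_field using assms(4) by (intro exI[of _ "min \<delta>\<^sub>0 1"]) auto
  then have "\<forall>\<^sub>F \<delta> in at_right 0. ereal (ln (real (covering_number \<delta> E)) / - ln \<delta>)
      \<le> ereal (ln A / - ln \<delta> + t)"
  proof eventually_elim
    case (elim \<delta>)
    have ge1: "covering_number \<delta> E \<ge> 1"
      using covering_number_pos[OF assms(1,2)] elim by blast
    have "ln (real (covering_number \<delta> E)) \<le> ln (A * \<delta> powr - t)"
      using assms(3) assms(5)[of \<delta>] elim ge1 by (intro ln_mono) auto
    also have "\<dots> = ln A + t * - ln \<delta>"
      using assms(3) elim by (simp add: ln_mult ln_powr)
    finally have "ln (real (covering_number \<delta> E)) / - ln \<delta> \<le> (ln A + t * - ln \<delta>) / - ln \<delta>"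
      using elim by (intro divide_right_mono) auto
    also have "\<dots> = ln A / - ln \<delta> + t" using elim by (simp add: field_simps)
    finally show ?case by simp
  qed
  then show ?thesis unfolding upper_box_dim_def lim[symmetric] by (rule Limsup_mono)
qed

section \<open>The renewal inequality\<close>

text \<open>
  The bound \<open>A * \<delta> powr - t\<close> is a supersolution of the inequality when \<open>A \<ge> 1 / (1 - q)\<close> with
  \<open>q = (\<Sum>i\<in>I. r i powr t)\<close>. Below \<open>\<delta>\<^sub>0\<close> the inequality refers only to scales at most \<open>\<delta>\<^sub>0 / Min (r ` I)\<close>
  that are larger by a factor of at least \<open>1 / Max (r ` I)\<close>, so finitely many steps lead back to
  scales between \<open>\<delta>\<^sub>0\<close> and \<open>\<delta>\<^sub>0 / Min (r ` I)\<close>, where monotonicity bounds \<open>M\<close> by \<open>M \<delta>\<^sub>0\<close>.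
\<close>

lemma renewal_inequality_powr_bound:
  fixes M :: "real \<Rightarrow> real" and r :: "'i \<Rightarrow> real"
  assumes I: "finite I" "I \<noteq> {}" and r: "\<And>i. i \<in> I \<Longrightarrow> 0 < r i \<and> r i < 1"
    and t: "t \<ge> 0" and q: "(\<Sum>i\<in>I. r i powr t) < 1" and \<delta>\<^sub>0: "\<delta>\<^sub>0 > 0"
    and antimono: "\<And>\<delta> \<epsilon>. 0 < \<delta> \<Longrightarrow> \<delta> \<le> \<epsilon> \<Longrightarrow> M \<epsilon> \<le> M \<delta>"
    and renewal: "\<And>\<delta>. 0 < \<delta> \<Longrightarrow> \<delta> < \<delta>\<^sub>0 \<Longrightarrow> M \<delta> \<le> (\<Sum>i\<in>I. M (\<delta> / r i)) + \<delta> powr - t"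
  obtains A where "A > 0" "\<And>\<delta>. 0 < \<delta> \<Longrightarrow> \<delta> < \<delta>\<^sub>0 \<Longrightarrow> M \<delta> \<le> A * \<delta> powr - t"
proof -
  define q where "q = (\<Sum>i\<in>I. r i powr t)"
  define a where "a = Min (r ` I)"
  define b where "b = Max (r ` I)"
  have "a \<in> r ` I" "b \<in> r ` I" unfolding a_def b_def
    using I Min_in[of "r ` I"] Max_in[of "r ` I"] by simp_all
  then have ab: "0 < a" "a < 1" "0 < b" "b < 1" using r by auto
  have bounds: "a \<le> r i" "r i \<le> b" if "i \<in> I" for i
    unfolding a_def b_def using I that by auto
  have q1: "q < 1" using q by (simp add: q_def)
  define A where "A = max (1 / (1 - q)) (M \<delta>\<^sub>0 * (\<delta>\<^sub>0 / a) powr t)"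
  have A: "1 / (1 - q) \<le> A" "M \<delta>\<^sub>0 * (\<delta>\<^sub>0 / a) powr t \<le> A" by (simp_all add: A_def)
  have "0 < 1 / (1 - q)" using q1 by simp
  then have A0: "0 < A" using A(1) by linarith
  have supersolution: "A * q + 1 \<le> A"
    using A(1) q1 by (simp add: pos_divide_le_eq algebra_simps)
  have coarse: "M \<delta> \<le> A * \<delta> powr - t" if "\<delta>\<^sub>0 \<le> \<delta>" "\<delta> \<le> \<delta>\<^sub>0 / a" for \<delta>
  proof -
    have "M \<delta> \<le> M \<delta>\<^sub>0" using antimono that(1) \<delta>\<^sub>0 by blast
    also have "M \<delta>\<^sub>0 \<le> A * (\<delta>\<^sub>0 / a) powr - t"
      using A(2) \<delta>\<^sub>0 ab(1) by (simp add: powr_minus_divide pos_le_divide_eq)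
    also have "\<dots> \<le> A * \<delta> powr - t"
      using A0 t that \<delta>\<^sub>0 by (intro mult_left_mono powr_mono2') auto
    finally show ?thesis .
  qed
  have all: "M \<delta> \<le> A * \<delta> powr - t" if "\<delta>\<^sub>0 * b ^ n \<le> \<delta>" "\<delta> \<le> \<delta>\<^sub>0 / a" for n \<delta>
    using that
  proof (induction n arbitrary: \<delta>)
    case 0
    then show ?case using coarse by simp
  next
    case (Suc n)
    show ?case
    proof (cases "\<delta>\<^sub>0 \<le> \<delta>")
      case True
      then show ?thesis using coarse Suc.prems by blast
    next
      case False
      have \<delta>: "0 < \<delta>" using Suc.prems(1) \<delta>\<^sub>0 ab(3) by (meson less_le_trans mult_pos_pos zero_less_power)
      have IH: "M (\<delta> / r i) \<le> A * (\<delta> powr - t * r i powr t)" if i: "i \<in> I" for i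
      proof -
        have "\<delta>\<^sub>0 * b ^ n * r i \<le> \<delta>\<^sub>0 * b ^ n * b"
          using bounds(2)[OF i] \<delta>\<^sub>0 ab(3) by (intro mult_left_mono) auto
        then have "\<delta>\<^sub>0 * b ^ n \<le> \<delta> / r i"
          using Suc.prems(1) r[OF i] by (simp add: pos_le_divide_eq mult_ac)
        moreover have "\<delta> / r i \<le> \<delta>\<^sub>0 / a"
          using False \<delta> bounds(1)[OF i] ab(1) \<delta>\<^sub>0 by (intro frac_le) auto
        ultimately have "M (\<delta> / r i) \<le> A * (\<delta> / r i) powr - t" by (rule Suc.IH)
        also have "(\<delta> / r i) powr - t = \<delta> powr - t * r i powr t"
          using \<delta> r[OF i] by (simp add: powr_divide powr_minus_divide)
        finally show ?thesis .
      qed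
      have "M \<delta> \<le> (\<Sum>i\<in>I. M (\<delta> / r i)) + \<delta> powr - t" using renewal \<delta> False by simp
      also have "\<dots> \<le> (\<Sum>i\<in>I. A * (\<delta> powr - t * r i powr t)) + \<delta> powr - t"
        using IH by (intro add_right_mono sum_mono)
      also have "\<dots> = (A * q + 1) * \<delta> powr - t"
        by (simp add: q_def flip: sum_distrib_left) (simp add: algebra_simps)
      also have "\<dots> \<le> A * \<delta> powr - t" using supersolution by (intro mult_right_mono) auto
      finally show ?thesis .
    qed
  qed
  show thesis
  proof (rule that[OF A0])
    fix \<delta> :: real assume \<delta>: "0 < \<delta>" "\<delta> < \<delta>\<^sub>0"
    obtain n where "b ^ n < \<delta> / \<delta>\<^sub>0" using real_arch_pow_inv[of "\<delta> / \<delta>\<^sub>0" b] \<delta> ab \<delta>\<^sub>0 by auto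
    then have "\<delta>\<^sub>0 * b ^ n \<le> \<delta>" using \<delta>\<^sub>0 by (simp add: pos_less_divide_eq mult.commute)
    moreover have "\<delta>\<^sub>0 \<le> \<delta>\<^sub>0 / a"
      using \<delta>\<^sub>0 ab(1,2) by (simp add: pos_le_divide_eq mult_left_le)
    then have "\<delta> \<le> \<delta>\<^sub>0 / a" using \<delta>(2) by linarith
    ultimately show "M \<delta> \<le> A * \<delta> powr - t" by (rule all)
  qed
qed

section \<open>Similarities and attractors\<close>

lemma similarity_ifsD:
  assumes "similarity_ifs X N S r"
  shows "N \<ge> 1"
    and "i \<in> {1..N} \<Longrightarrow> S i ` X \<subseteq> X"
    and "i \<in> {1..N} \<Longrightarrow> 0 < r i \<and> r i < 1"
    and "i \<in> {1..N} \<Longrightarrow> x \<in> X \<Longrightarrow> y \<in> X \<Longrightarrow> dist (S i x) (S i y) = r i * dist x y"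
  using assms by (auto simp: similarity_ifs_def)

lemma similarity_ifs_subset:
  assumes "similarity_ifs X N S r" "F \<subseteq> X" "\<And>i. i \<in> {1..N} \<Longrightarrow> S i ` F \<subseteq> F"
  shows "similarity_ifs F N S r"
  using assms unfolding similarity_ifs_def by blast

lemma similarity_ifs_compact_image:
  assumes "similarity_ifs X N S r" "i \<in> {1..N}" "F \<subseteq> X" "compact F"
  shows "compact (S i ` F)"
proof (rule compact_continuous_image[OF lipschitz_on_continuous_on assms(4)])
  show "(r i)-lipschitz_on F (S i)"
  proof (rule lipschitz_onI)
    fix x y assume "x \<in> F" "y \<in> F"
    then show "dist (S i x) (S i y) \<le> r i * dist x y"
      using similarity_ifsD(4)[OF assms(1,2)] assms(3) by (auto simp: subset_iff)
  qed (use similarity_ifsD(3)[OF assms(1,2)] in simp)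
qed

lemma is_attractor_attractor:
  assumes "compact X" "X \<noteq> {}" "similarity_ifs X N S r" "compact C" "C \<subseteq> X"
  shows "is_attractor X N S C (attractor X N S C)"
  unfolding attractor_def by (rule theI') (rule attractor_ex1[OF assms])

text \<open>
  Restricting the system to an invariant compact set \<open>F\<close> gives a homogeneous attractor inside \<open>F\<close>, and
  by uniqueness it is the one of the whole space.
\<close>

lemma homogeneous_attractor_subset:
  assumes X: "compact X" and ifs: "similarity_ifs X N S r"
    and F: "compact F" "F \<noteq> {}" "F \<subseteq> X" "\<And>i. i \<in> {1..N} \<Longrightarrow> S i ` F \<subseteq> F"
  shows "attractor X N S {} \<subseteq> F"
proof -
  have "X \<noteq> {}" using F by blast
  have "is_attractor F N S {} (attractor F N S {})"
    using F by (intro is_attractor_attractor[OF _ _ similarity_ifs_subset[OF ifs]]) auto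
  then have sub: "attractor F N S {} \<subseteq> F" and "is_attractor X N S {} (attractor F N S {})"
    using F(3) unfolding is_attractor_def by blast+
  then have "attractor F N S {} = attractor X N S {}"
    using attractor_ex1[OF X \<open>X \<noteq> {}\<close> ifs, of "{}"]
      is_attractor_attractor[OF X \<open>X \<noteq> {}\<close> ifs, of "{}"] by auto
  then show ?thesis using sub by simp
qed

lemma covering_number_self_similar_le:
  assumes ifs: "similarity_ifs X N S r" and C: "compact C" and F: "is_attractor X N S C F"
    and \<delta>: "\<delta> > 0"
  shows "covering_number \<delta> F
    \<le> (\<Sum>i=1..N. covering_number (\<delta> / r i) F) + covering_number \<delta> C"
proof -
  have FX: "F \<subseteq> X" "compact F" and F_eq: "F = (\<Union>i\<in>{1..N}. S i ` F) \<union> C"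
    using F unfolding is_attractor_def by blast+
  have cpt: "compact (S i ` F)" if "i \<in> {1..N}" for i
    using similarity_ifs_compact_image[OF ifs that FX] .
  have "covering_number \<delta> F = covering_number \<delta> ((\<Union>i\<in>{1..N}. S i ` F) \<union> C)"
    using F_eq by simp
  also have "\<dots> \<le> covering_number \<delta> (\<Union>i\<in>{1..N}. S i ` F) + covering_number \<delta> C"
    by (intro covering_number_Un_le compact_UN cpt C \<delta>) auto
  also have "covering_number \<delta> (\<Union>i\<in>{1..N}. S i ` F) \<le> (\<Sum>i=1..N. covering_number \<delta> (S i ` F))"
    by (intro covering_number_UN_le cpt \<delta>) auto
  also have "\<dots> \<le> (\<Sum>i=1..N. covering_number (\<delta> / r i) F)"
  proof (rule sum_mono)
    fix i assume i: "i \<in> {1..N}"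
    show "covering_number \<delta> (S i ` F) \<le> covering_number (\<delta> / r i) F"
    proof (rule covering_number_image_le[OF FX(2) \<delta>])
      show "r i > 0" using similarity_ifsD(3)[OF ifs i] by simp
      fix x y assume "x \<in> F" "y \<in> F"
      then show "dist (S i x) (S i y) \<le> r i * dist x y"
        using similarity_ifsD(4)[OF ifs i] FX(1) by (auto simp: subset_iff)
    qed
  qed
  finally show ?thesis by simp
qed

lemma sum_powr_similarity_dim:
  assumes "similarity_ifs X N S r"
  shows "(\<Sum>i=1..N. r i powr similarity_dim N r) = 1"
  unfolding similarity_dim_def by (rule theI') (rule similarity_dim_ex1[OF assms])

text \<open>
  A single term \<open>r 1 powr s\<close> with \<open>s < 0\<close> already exceeds \<open>1\<close>. Nonnegativity makes \<open>\<delta> powr - t\<close>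
  decreasing in \<open>\<delta>\<close> for every exponent \<open>t\<close> above the similarity dimension.
\<close>

lemma similarity_dim_nonneg:
  assumes ifs: "similarity_ifs X N S r"
  shows "similarity_dim N r \<ge> 0"
proof (rule ccontr)
  assume neg: "\<not> similarity_dim N r \<ge> 0"
  have one: "1 \<in> {1..N}" using similarity_ifsD(1)[OF ifs] by simp
  have "r 1 powr 0 < r 1 powr similarity_dim N r"
    using similarity_ifsD(3)[OF ifs one] neg by (intro powr_less_mono') auto
  then have "1 < r 1 powr similarity_dim N r" using similarity_ifsD(3)[OF ifs one] by simp
  also have "\<dots> \<le> (\<Sum>i=1..N. r i powr similarity_dim N r)"
    using one by (intro member_le_sum) auto
  finally show False using sum_powr_similarity_dim[OF ifs] by simp
qed

lemma sum_powr_less_one: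
  assumes ifs: "similarity_ifs X N S r" and "similarity_dim N r < t"
  shows "(\<Sum>i=1..N. r i powr t) < 1"
proof -
  have "(\<Sum>i=1..N. r i powr t) < (\<Sum>i=1..N. r i powr similarity_dim N r)"
    using similarity_ifsD(1,3)[OF ifs] assms(2) by (intro sum_strict_mono powr_less_mono') auto
  then show ?thesis using sum_powr_similarity_dim[OF ifs] by simp
qed

lemma upper_box_dim_attractor_le:
  assumes ifs: "similarity_ifs X N S r" and C: "compact C" and F: "is_attractor X N S C F"
    and t: "similarity_dim N r < t" "upper_box_dim C < ereal t"
  shows "upper_box_dim F \<le> ereal t"
proof -
  have cF: "compact F" "F \<noteq> {}" using F unfolding is_attractor_def by blast+
  obtain \<delta>\<^sub>0 where \<delta>\<^sub>0: "\<delta>\<^sub>0 > 0"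
    "\<And>\<delta>. 0 < \<delta> \<Longrightarrow> \<delta> < \<delta>\<^sub>0 \<Longrightarrow> real (covering_number \<delta> C) \<le> \<delta> powr - t"
    using covering_number_powr_bound_of_upper_box_dim_less[OF t(2)] by blast
  define M where "M \<delta> = real (covering_number \<delta> F)" for \<delta>
  have M_antimono: "M \<epsilon> \<le> M \<delta>" if "0 < \<delta>" "\<delta> \<le> \<epsilon>" for \<delta> \<epsilon>
    unfolding M_def using covering_number_antimono_scale[OF cF(1) that] by simp
  have M_renewal: "M \<delta> \<le> (\<Sum>i\<in>{1..N}. M (\<delta> / r i)) + \<delta> powr - t" if \<delta>: "0 < \<delta>" "\<delta> < \<delta>\<^sub>0" for \<delta>
  proof -
    have "M \<delta> \<le> real ((\<Sum>i=1..N. covering_number (\<delta> / r i) F) + covering_number \<delta> C)"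
      unfolding M_def using covering_number_self_similar_le[OF ifs C F \<delta>(1)] by (rule of_nat_mono)
    then show ?thesis using \<delta>\<^sub>0(2)[OF \<delta>] by (simp add: M_def)
  qed
  obtain A where "A > 0" "\<And>\<delta>. 0 < \<delta> \<Longrightarrow> \<delta> < \<delta>\<^sub>0 \<Longrightarrow> M \<delta> \<le> A * \<delta> powr - t"
  proof (rule renewal_inequality_powr_bound[of "{1..N}" r t \<delta>\<^sub>0 M])
    show "{1..N} \<noteq> {}" using similarity_ifsD(1)[OF ifs] by simp
    show "0 \<le> t" using similarity_dim_nonneg[OF ifs] t(1) by simp
  qed (use similarity_ifsD(3)[OF ifs] sum_powr_less_one[OF ifs t(1)] \<delta>\<^sub>0(1) M_antimono M_renewal in auto)
  then show ?thesis
    unfolding M_def by (rule upper_box_dim_le_of_covering_number_powr_bound[OF cF _ \<delta>\<^sub>0(1)])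
qed

theorem theorem2p1:
  fixes X C :: "'a::metric_space set"
    and N :: nat
    and S :: "nat \<Rightarrow> 'a \<Rightarrow> 'a"
    and r :: "nat \<Rightarrow> real"
  assumes "compact X"
    and "similarity_ifs X N S r"
    and "C \<subseteq> X" and "C \<noteq> {}" and "compact C"
  shows "max (upper_box_dim (attractor X N S {})) (upper_box_dim C)
           \<le> upper_box_dim (attractor X N S C)
       \<and> upper_box_dim (attractor X N S C)
           \<le> max (ereal (similarity_dim N r)) (upper_box_dim C)"
proof -
  let ?F = "attractor X N S C"
  have "X \<noteq> {}" using assms(3,4) by blast
  then have F: "is_attractor X N S C ?F"
    using is_attractor_attractor[OF assms(1) _ assms(2,5,3)] by blast
  then have F_facts: "compact ?F" "?F \<noteq> {}" "?F \<subseteq> X"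
    "\<And>i. i \<in> {1..N} \<Longrightarrow> S i ` ?F \<subseteq> ?F" "C \<subseteq> ?F"
    unfolding is_attractor_def by blast+
  have "attractor X N S {} \<subseteq> ?F"
    using homogeneous_attractor_subset[OF assms(1,2) F_facts(1-4)] .
  then have lower: "max (upper_box_dim (attractor X N S {})) (upper_box_dim C) \<le> upper_box_dim ?F"
    using upper_box_dim_mono[OF F_facts(1)] F_facts(5) by simp
  have upper: "upper_box_dim ?F \<le> max (ereal (similarity_dim N r)) (upper_box_dim C)"
    \<comment> \<open>It suffices to bound by every \<open>u\<close> above the maximum; such a \<open>u\<close> is either \<open>\<infinity>\<close> or a real exponent.\<close>
  proof (rule dense_ge)
    fix u assume u: "max (ereal (similarity_dim N r)) (upper_box_dim C) < u"
    then show "upper_box_dim ?F \<le> u"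
      using upper_box_dim_attractor_le[OF assms(2,5) F] by (cases u) auto
  qed
  show ?thesis using lower upper by blast
qed

end
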